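(* Let $P\subset\mathbb R^N$ be a full-dimensional lattice polytope satisfying the standing assumptions of the context, let $\mathrm{PC}_P$ be its projective toric code over $\mathbb F_q$ with evaluation map $\mathrm{ev}_P$, and let $\mathrm{Red}(P)$ be a projective reduction of $P$. For $m\in P\cap\mathbb Z^N$ let $\overline m$ denote the unique element of $\mathrm{Red}(P)$ with $\overline m\sim_P m$. Then $$\ker \mathrm{ev}_P=\mathrm{Span}_{\mathbb F_q}\left\{\chi^{\langle m,P\rangle}-\chi^{\langle \overline m,P\rangle} : m\in P\cap\mathbb Z^N,\ m\neq\overline m\right\},$$ and the set $$\left\{\mathrm{ev}_P\left(\chi^{\langle \overline m,P\rangle}\right) : \overline m\in\mathrm{Red}(P)\right\}$$ forms a basis of the code $\mathrm{PC}_P$. The dimension of $\mathrm{PC}_P$ is $\dim\mathrm{PC}_P=\#\mathrm{Red}(P)$.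
   Context: Setting. $\mathbb F_q$ is the finite field with $q$ elements, $p$ its characteristic, $\overline{\mathbb F_q}$ an algebraic closure. $P\subset\mathbb R^N$ is a full-dimensional convex lattice polytope. Faces are nonempty; $Q\preceq P$ means $Q$ is a face of $P$ ($P$ itself included); $P(k)$ is the set of $k$-dimensional faces; the elements of $P(N-1)$ are the facets and $r=\#P(N-1)$. For a facet $F$, $u_F\in\mathbb Z^N$ is the shortest (primitive) inner normal vector of $F$ with integer coordinates. Standing assumptions: $P$ is simple (each vertex belongs to exactly $N$ facets), and for every vertex $v$ the determinant of the $N\times N$ matrix $A(v)$ whose rows are the vectors $u_F$, $F\ni v$, is coprime to $p$. Toric variety. Let $\mathcal Z\subset\overline{\mathbb F_q}^{\,r}$ (coordinates $x_F$ indexed by facets) be the common zero set of the monomials $\prod_{F\not\ni v}X_F$, $v\in P(0)$, and $G=\{(t_F)\in(\overline{\mathbb F_q}^* )^r:\prod_F t_F^{u_F^{(j)}}=1\ \forall j=1,\dots,N\}$, acting coordinatewise: $\mathbf t\cdot\mathbf x=(t_Fx_F)_F$. The points of the toric variety $\mathbf X_P$ are the $G$-orbits in $\overline{\mathbb F_q}^{\,r}\setminus\mathcal Z$; a point is $\mathbb F_q$-rational if its orbit is stable under $\mathbf x\mapsto\mathbf x^q=(x_F^q)_F$. For a face $Q$, $\mathbb T_Q\subset\mathbf X_P$ is the set of points whose coordinates satisfy $x_F=0$ exactly when $F\supseteq Q$; $\mathbf X_P$ is the disjoint union of the $\mathbb T_Q$. For a vertex $v$ of $Q$, a $v$-normalized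 representative of a point of $\mathbb T_Q$ is a tuple $\mathbf x$ in its orbit with $x_F=1$ for all $F\not\ni v$ (and $x_F=0$ for $F\supseteq Q$); a normalized representative is a $v$-normalized one for some such $v$. Code. Let $\alpha_F\in\mathbb Z$ be such that $P=\{m\in\mathbb R^N:\langle m,u_F\rangle\ge-\alpha_F\ \forall F\}$ with each inequality tight on the facet $F$. For $m\in P\cap\mathbb Z^N$ put $\chi^{\langle m,P\rangle}=\prod_F X_F^{\langle m,u_F\rangle+\alpha_F}\in\mathbb F_q[X_F: F\in P(N-1)]$, and let $L(D)$ be the $\mathbb F_q$-span of these monomials. Choose a set $\mathcal P$ of normalized representatives, one for each $\mathbb F_q$-rational point of $\mathbf X_P$, and let $n=\#\mathbf X_P(\mathbb F_q)$. Then $\mathrm{ev}_P:L(D)\to\mathbb F_q^n$, $f\mapsto(f(\mathbf x))_{\mathbf x\in\mathcal P}$ (convention $0^0=1$), and the projective toric code is $\mathrm{PC}_P=\mathrm{ev}_P(L(D))$. Projective reduction. For a face $Q$, $Q^\circ$ is the set of points of $Q$ lying in no proper face of $Q$ (so $Q^\circ=Q$ for a vertex). On $P\cap\mathbb Z^N$, $m\sim_P m'$ iff there is a face $Q\preceq P$ with $m,m'\in Q^\circ$ and $m-m'\in(q-1)\mathbb Z^N$. A projective reduction $\mathrm{Red}(P)$ of $P$ is any set of representatives of $P\cap\mathbb Z^N$ modulo $\sim_P$ (exactly one element in each class). *)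

theory Defs
  imports
    "HOL-Analysis.Analysis"
    "HOL-Algebra.Algebraic_Closure_Type"
    "HOL-Library.Poly_Mapping"
    "HOL-Library.Function_Algebras"
begin

unbundle no fps_syntax

section \<open>Lattice polytopes\<close>

definition rvec :: "int ^ 'n \<Rightarrow> real ^ 'n" where
  "rvec m = (\<chi> j. real_of_int (m $ j))"

definition idot :: "int ^ 'n \<Rightarrow> int ^ 'n \<Rightarrow> int" where
  "idot m u = (\<Sum>j\<in>UNIV. m $ j * u $ j)"

definition lattice_polytope :: "(real ^ 'n) set \<Rightarrow> bool" where
  "lattice_polytope P \<longleftrightarrow> (\<exists>V. finite V \<and> P = convex hull (rvec ` V))"

definition lattice_points :: "(real ^ 'n) set \<Rightarrow> (int ^ 'n) set" where
  "lattice_points P = {m. rvec m \<in> P}"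

definition facets :: "(real ^ 'n) set \<Rightarrow> (real ^ 'n) set set" where
  "facets P = {F. F facet_of P}"

definition vertices :: "(real ^ 'n) set \<Rightarrow> (real ^ 'n) set" where
  "vertices P = {v. v extreme_point_of P}"

definition simple_polytope :: "(real ^ 'n) set \<Rightarrow> bool" where
  "simple_polytope P \<longleftrightarrow> (\<forall>v\<in>vertices P. card {F \<in> facets P. v \<in> F} = CARD('n))"

definition inner_normal :: "(real ^ 'n) set \<Rightarrow> (real ^ 'n) set \<Rightarrow> int ^ 'n \<Rightarrow> bool" where
  "inner_normal P F u \<longleftrightarrow> u \<noteq> 0 \<and> (\<forall>y\<in>P. \<forall>x\<in>F. x \<bullet> rvec u \<le> y \<bullet> rvec u)"

text \<open>
  The vector \<open>u\<^sub>F\<close>. For a facet of a full-dimensional lattice polytope, the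
  inner normals all lie on one rational ray, so the shortest integral one is unique.
\<close>

definition facet_normal :: "(real ^ 'n) set \<Rightarrow> (real ^ 'n) set \<Rightarrow> int ^ 'n" where
  "facet_normal P F = (ARG_MIN (\<lambda>u. norm (rvec u)) u. inner_normal P F u)"

text \<open>
  The matrix \<open>A(v)\<close> is only determined up to the order of its rows; \<open>\<sigma>\<close> runs
  over all orderings (there is one as soon as the polytope is simple).
\<close>

definition vertex_dets_coprime :: "nat \<Rightarrow> (real ^ 'n) set \<Rightarrow> bool" where
  "vertex_dets_coprime p P \<longleftrightarrow>
     (\<forall>v\<in>vertices P. \<forall>\<sigma> :: 'n \<Rightarrow> (real ^ 'n) set.
        bij_betw \<sigma> UNIV {F \<in> facets P. v \<in> F} \<longrightarrow>
        coprime (det (\<chi> i. facet_normal P (\<sigma> i))) (int p))"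

text \<open>
  The integers \<open>\<alpha>\<^sub>F\<close>; only the values of \<open>\<alpha>\<close> on facets matter.
\<close>

definition facet_offsets :: "(real ^ 'n) set \<Rightarrow> ((real ^ 'n) set \<Rightarrow> int) \<Rightarrow> bool" where
  "facet_offsets P \<alpha> \<longleftrightarrow>
     P = {x. \<forall>F\<in>facets P. x \<bullet> rvec (facet_normal P F) \<ge> - real_of_int (\<alpha> F)} \<and>
     (\<forall>F\<in>facets P. \<forall>x\<in>F. x \<bullet> rvec (facet_normal P F) = - real_of_int (\<alpha> F))"


section \<open>Projective reduction\<close>

text \<open>Not the topological interior: the points of \<open>Q\<close> on no proper face of \<open>Q\<close>.\<close>

definition face_interior :: "(real ^ 'n) set \<Rightarrow> (real ^ 'n) set" where
  "face_interior Q = {x \<in> Q. \<forall>Q'. Q' face_of Q \<and> Q' \<noteq> Q \<longrightarrow> x \<notin> Q'}"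

definition proj_equiv :: "nat \<Rightarrow> (real ^ 'n) set \<Rightarrow> int ^ 'n \<Rightarrow> int ^ 'n \<Rightarrow> bool" where
  "proj_equiv q P m m' \<longleftrightarrow>
     (\<exists>Q. Q face_of P \<and> Q \<noteq> {} \<and> rvec m \<in> face_interior Q \<and> rvec m' \<in> face_interior Q) \<and>
     (\<exists>z. \<forall>j. (m - m') $ j = (int q - 1) * z $ j)"

definition projective_reduction :: "nat \<Rightarrow> (real ^ 'n) set \<Rightarrow> (int ^ 'n) set \<Rightarrow> bool" where
  "projective_reduction q P R \<longleftrightarrow>
     R \<subseteq> lattice_points P \<and> (\<forall>m\<in>lattice_points P. \<exists>!r. r \<in> R \<and> proj_equiv q P r m)"

definition reduce :: "nat \<Rightarrow> (real ^ 'n) set \<Rightarrow> (int ^ 'n) set \<Rightarrow> int ^ 'n \<Rightarrow> int ^ 'n" where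
  "reduce q P R m = (THE r. r \<in> R \<and> proj_equiv q P r m)"


section \<open>The toric variety and its rational points\<close>

text \<open>
  Tuples indexed by the facets are extensional functions, so that distinct functions
  are distinct tuples. The base field is the type \<open>'k\<close>, with \<open>q = CARD('k)\<close>.
\<close>

type_synonym ('n, 'k) coords = "(real ^ 'n) set \<Rightarrow> 'k alg_closure"

definition affine_tuples :: "(real ^ 'n) set \<Rightarrow> ('n, 'k::field) coords set" where
  "affine_tuples P = facets P \<rightarrow>\<^sub>E UNIV"

definition irrelevant_locus :: "(real ^ 'n) set \<Rightarrow> ('n, 'k::field) coords set" where
  "irrelevant_locus P =
     {x \<in> affine_tuples P. \<forall>v\<in>vertices P. (\<Prod>F | F \<in> facets P \<and> v \<notin> F. x F) = 0}"

definition toric_group :: "(real ^ 'n) set \<Rightarrow> ('n, 'k::field) coords set" where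
  "toric_group P =
     {t \<in> facets P \<rightarrow>\<^sub>E - {0}. \<forall>j. (\<Prod>F\<in>facets P. t F powi (facet_normal P F $ j)) = 1}"

definition act :: "(real ^ 'n) set \<Rightarrow> ('n, 'k::field) coords \<Rightarrow> ('n, 'k) coords \<Rightarrow> ('n, 'k) coords" where
  "act P t x = (\<lambda>F\<in>facets P. t F * x F)"

definition toric_points :: "(real ^ 'n) set \<Rightarrow> ('n, 'k::field) coords set set" where
  "toric_points P =
     {(\<lambda>t. act P t x) ` toric_group P | x. x \<in> affine_tuples P - irrelevant_locus P}"

definition frobenius :: "(real ^ 'n) set \<Rightarrow> ('n, 'k::{field,finite}) coords \<Rightarrow> ('n, 'k) coords" where
  "frobenius P x = (\<lambda>F\<in>facets P. x F ^ CARD('k))"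

definition rational_points :: "(real ^ 'n) set \<Rightarrow> ('n, 'k::{field,finite}) coords set set" where
  "rational_points P = {Y \<in> toric_points P. (\<forall>x\<in>Y. frobenius P x \<in> Y)}"

definition torus_stratum ::
    "(real ^ 'n) set \<Rightarrow> (real ^ 'n) set \<Rightarrow> ('n, 'k::field) coords set set" where
  "torus_stratum P Q =
     {Y \<in> toric_points P. \<forall>x\<in>Y. \<forall>F\<in>facets P. x F = 0 \<longleftrightarrow> Q \<subseteq> F}"

definition normalized_rep ::
    "(real ^ 'n) set \<Rightarrow> ('n, 'k::field) coords set \<Rightarrow> ('n, 'k) coords \<Rightarrow> bool" where
  "normalized_rep P Y x \<longleftrightarrow>
     (\<exists>Q v. Q face_of P \<and> Q \<noteq> {} \<and> Y \<in> torus_stratum P Q \<and> v \<in> vertices Q \<and> x \<in> Y \<and>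
        (\<forall>F\<in>facets P. v \<notin> F \<longrightarrow> x F = 1) \<and> (\<forall>F\<in>facets P. Q \<subseteq> F \<longrightarrow> x F = 0))"

definition normalized_rep_system ::
    "(real ^ 'n) set \<Rightarrow> ('n, 'k::{field,finite}) coords set \<Rightarrow> bool" where
  "normalized_rep_system P S \<longleftrightarrow>
     (\<exists>\<rho>. (\<forall>Y\<in>rational_points P. normalized_rep P Y (\<rho> Y)) \<and> S = \<rho> ` rational_points P)"


section \<open>The code\<close>

text \<open>
  Polynomials over \<open>'a\<close> in variables \<open>X\<^sub>F\<close> are finitely supported functions from
  exponent vectors to coefficients.
\<close>

type_synonym ('x, 'a) mpol = "('x \<Rightarrow>\<^sub>0 nat) \<Rightarrow>\<^sub>0 'a"

definition mpol_scale :: "'a::field \<Rightarrow> ('x, 'a) mpol \<Rightarrow> ('x, 'a) mpol" where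
  "mpol_scale c f = Poly_Mapping.map ((*) c) f"

interpretation mpol: vector_space "mpol_scale :: 'a::field \<Rightarrow> ('x, 'a) mpol \<Rightarrow> ('x, 'a) mpol"
  by standard
    (simp_all add: mpol_scale_def mult_map_scale_conv_mult algebra_simps single_add
      mult.assoc [symmetric] mult_single)

definition mpol_var :: "'x \<Rightarrow> ('x, 'a::field) mpol" where
  "mpol_var F = Poly_Mapping.single (Poly_Mapping.single F 1) 1"

definition mpol_eval :: "('x \<Rightarrow> 'k alg_closure) \<Rightarrow> ('x, 'k::field) mpol \<Rightarrow> 'k alg_closure" where
  "mpol_eval x f =
     (\<Sum>e\<in>Poly_Mapping.keys f. to_ac (Poly_Mapping.lookup f e) *
        (\<Prod>F\<in>Poly_Mapping.keys e. x F ^ Poly_Mapping.lookup e F))"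

definition chi ::
    "(real ^ 'n) set \<Rightarrow> ((real ^ 'n) set \<Rightarrow> int) \<Rightarrow> int ^ 'n \<Rightarrow> ((real ^ 'n) set, 'k::field) mpol" where
  "chi P \<alpha> m = (\<Prod>F\<in>facets P. mpol_var F ^ nat (idot m (facet_normal P F) + \<alpha> F))"

definition L_space ::
    "(real ^ 'n) set \<Rightarrow> ((real ^ 'n) set \<Rightarrow> int) \<Rightarrow> ((real ^ 'n) set, 'k::field) mpol set" where
  "L_space P \<alpha> = mpol.span (chi P \<alpha> ` lattice_points P)"

text \<open>
  The space of words indexed by a set \<open>S\<close> is the space of functions that vanish
  outside \<open>S\<close>. A normalized representative of a rational point may have coordinates
  outside \<open>'k\<close>, so polynomials are evaluated over the algebraic closure; the values
  of the elements of \<^term>\<open>L_space P \<alpha>\<close> do lie in \<open>'k\<close> (lemma \<open>mpol_eval_in_range\<close>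
  below), and \<^const>\<open>of_ac\<close> regards them as elements of \<open>'k\<close>.
\<close>

definition ev :: "('x \<Rightarrow> 'k alg_closure) set \<Rightarrow> ('x, 'k::field) mpol \<Rightarrow> ('x \<Rightarrow> 'k alg_closure) \<Rightarrow> 'k" where
  "ev S f = (\<lambda>x. if x \<in> S then of_ac (mpol_eval x f) else 0)"

definition word_scale :: "'a::field \<Rightarrow> ('i \<Rightarrow> 'a) \<Rightarrow> 'i \<Rightarrow> 'a" where
  "word_scale c w = (\<lambda>i. c * w i)"

interpretation word: vector_space "word_scale :: 'a::field \<Rightarrow> ('i \<Rightarrow> 'a) \<Rightarrow> 'i \<Rightarrow> 'a"
  by standard (simp_all add: word_scale_def fun_eq_iff algebra_simps)

definition toric_code ::
    "(real ^ 'n) set \<Rightarrow> ((real ^ 'n) set \<Rightarrow> int) \<Rightarrow> ('n, 'k::{field,finite}) coords set \<Rightarrow>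
      (('n, 'k) coords \<Rightarrow> 'k) set" where
  "toric_code P \<alpha> S = ev S ` L_space P \<alpha>"


section \<open>The evaluation map takes values in the base field\<close>


lemma mpol_scale_lookup: "Poly_Mapping.lookup (mpol_scale c f) e = c * Poly_Mapping.lookup f e"
  by (simp add: mpol_scale_def map.rep_eq when_def)

lemma mpol_eval_superset:
  assumes "finite A" "Poly_Mapping.keys f \<subseteq> A"
  shows "mpol_eval x f = (\<Sum>e\<in>A. to_ac (Poly_Mapping.lookup f e) *
     (\<Prod>F\<in>Poly_Mapping.keys e. x F ^ Poly_Mapping.lookup e F))"
  unfolding mpol_eval_def using assms
  by (intro sum.mono_neutral_left) (auto simp: in_keys_iff)

lemma mpol_eval_add: "mpol_eval x (f + g) = mpol_eval x f + mpol_eval x g"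
proof -
  let ?A = "Poly_Mapping.keys f \<union> Poly_Mapping.keys g"
  have "Poly_Mapping.keys (f + g) \<subseteq> ?A"
    by (rule Poly_Mapping.keys_add)
  thus ?thesis
    by (simp add: mpol_eval_superset[of ?A] lookup_add distrib_right sum.distrib)
qed

lemma mpol_eval_scale: "mpol_eval x (mpol_scale c f) = to_ac c * mpol_eval x f"
proof -
  have "Poly_Mapping.keys (mpol_scale c f) \<subseteq> Poly_Mapping.keys f"
    by (auto simp: in_keys_iff mpol_scale_lookup)
  thus ?thesis
    by (simp add: mpol_eval_superset[of "Poly_Mapping.keys f"] mpol_scale_lookup mult.assoc
        sum_distrib_left)
qed

lemma mpol_eval_0: "mpol_eval x 0 = 0"
  by (simp add: mpol_eval_def)

lemma mpol_var_power: "mpol_var F ^ k = Poly_Mapping.single (Poly_Mapping.single F k) 1"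
  by (induction k) (simp_all add: mpol_var_def mult_single single_add [symmetric])

lemma chi_eq_single:
  assumes "finite (facets P)"
  shows "chi P \<alpha> m =
    Poly_Mapping.single (\<Sum>F\<in>facets P. Poly_Mapping.single F (nat (idot m (facet_normal P F) + \<alpha> F))) 1"
proof -
  have "(\<Prod>F\<in>A. mpol_var F ^ g F) =
    Poly_Mapping.single (\<Sum>F\<in>A. Poly_Mapping.single F (g F)) 1" if "finite A" for A g
    using that by (induction A rule: finite_induct) (simp_all add: mpol_var_power mult_single)
  from this[OF assms] show ?thesis unfolding chi_def .
qed

lemma mpol_eval_chi:
  assumes "finite (facets P)"
  shows "mpol_eval x (chi P \<alpha> m) =
    (\<Prod>F\<in>facets P. x F ^ nat (idot m (facet_normal P F) + \<alpha> F))"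
proof -
  define e where "e = (\<Sum>F\<in>facets P. Poly_Mapping.single F (nat (idot m (facet_normal P F) + \<alpha> F)))"
  have l: "Poly_Mapping.lookup e F =
     (if F \<in> facets P then nat (idot m (facet_normal P F) + \<alpha> F) else 0)" for F
    using assms unfolding e_def lookup_sum lookup_single by (simp add: when_def)
  have "mpol_eval x (chi P \<alpha> m) = (\<Prod>F\<in>Poly_Mapping.keys e. x F ^ Poly_Mapping.lookup e F)"
    unfolding chi_eq_single[OF assms] e_def [symmetric] by (simp add: mpol_eval_def)
  also have "\<dots> = (\<Prod>F\<in>facets P. x F ^ Poly_Mapping.lookup e F)"
    using assms by (intro prod.mono_neutral_left) (auto simp: in_keys_iff l split: if_splits)
  finally show ?thesis by (simp add: l)
qed

lemma finite_field_power_card_eq: "(a :: 'k::{field,finite}) ^ CARD('k) = a"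
proof (cases "a = 0")
  case False
  have "bij_betw ((*) a) (UNIV - {0}) (UNIV - {0})"
    by (rule bij_betwI[where g = "(*) (inverse a)"]) (use False in auto)
  hence "(\<Prod>y\<in>UNIV - {0}. a * y) = (\<Prod>y\<in>UNIV - {0 :: 'k}. y)"
    by (rule prod.reindex_bij_betw)
  hence "a ^ card (UNIV - {0 :: 'k}) * (\<Prod>y\<in>UNIV - {0 :: 'k}. y) = (\<Prod>y\<in>UNIV - {0 :: 'k}. y)"
    by (simp add: prod.distrib)
  hence "a ^ (CARD('k) - 1) = 1"
    by (simp add: card_Diff_singleton)
  hence "a * a ^ (CARD('k) - 1) = a" by simp
  thus ?thesis by (simp flip: power_Suc)
qed (auto simp: zero_power)

lemma frobenius_fixed_in_range:
  assumes "(y :: 'k::{field,finite} alg_closure) ^ CARD('k) = y"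
  shows "y \<in> range to_ac"
proof -
  define p :: "'k alg_closure poly" where "p = Polynomial.monom 1 CARD('k) - Polynomial.monom 1 1"
  have "(1::nat) < CARD('k)"
    using card_mono[of "UNIV :: 'k set" "{0, 1}"] by simp
  hence "Polynomial.coeff p CARD('k) = 1" "Polynomial.degree p \<le> CARD('k)"
    unfolding p_def by (auto intro!: degree_diff_le degree_monom_le order.trans[OF degree_monom_le])
  hence "p \<noteq> 0" "Polynomial.degree p \<le> CARD('k)" by auto
  have roots: "poly p z = 0 \<longleftrightarrow> z ^ CARD('k) = z" for z
    by (simp add: p_def poly_monom)
  have "range to_ac \<subseteq> {z. poly p z = 0}"
    by (auto simp: roots finite_field_power_card_eq simp flip: to_ac_power)
  moreover have "card (range (to_ac :: 'k \<Rightarrow> _)) = CARD('k)"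
    by (simp add: card_image inj_to_ac)
  moreover have "card {z. poly p z = 0} \<le> CARD('k)"
    using card_poly_roots_bound[OF \<open>p \<noteq> 0\<close>] \<open>Polynomial.degree p \<le> CARD('k)\<close> by simp
  moreover have "finite {z. poly p z = 0}"
    using \<open>p \<noteq> 0\<close> by (rule poly_roots_finite)
  ultimately have "range to_ac = {z. poly p z = 0}"
    by (metis card_seteq)
  thus ?thesis using assms roots by auto
qed

lemma rvec_inner: "rvec m \<bullet> rvec u = real_of_int (idot m u)"
  by (simp add: rvec_def idot_def inner_vec_def)

lemma mpol_eval_in_range:
  fixes S :: "('n::finite, 'k::{field,finite}) coords set"
  assumes P: "lattice_polytope P" and \<alpha>: "facet_offsets P \<alpha>"
    and S: "normalized_rep_system P S" and x: "x \<in> S" and f: "f \<in> L_space P \<alpha>"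
  shows "mpol_eval x f \<in> range to_ac"
proof -
  let ?u = "facet_normal P"
  obtain V where V: "finite V" "P = convex hull (rvec ` V)"
    using P by (auto simp: lattice_polytope_def)
  have "polytope P" using V by (auto simp: polytope_def)
  hence fin: "finite (facets P)"
    by (auto simp: facets_def finite_polytope_facets)
  obtain Y where Y: "Y \<in> rational_points P" and nx: "normalized_rep P Y x"
    using S x by (auto simp: normalized_rep_system_def)
  obtain Q v where Q: "Q face_of P" "v \<in> vertices Q" "x \<in> Y"
     and x1: "\<And>F. F \<in> facets P \<Longrightarrow> v \<notin> F \<Longrightarrow> x F = 1"
    using nx unfolding normalized_rep_def by blast
  have "v extreme_point_of P"
    using Q by (auto simp: vertices_def extreme_point_of_face)
  then obtain w where w: "v = rvec w"
    using V extreme_point_of_convex_hull by blast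
  obtain y where y: "Y = (\<lambda>t. act P t y) ` toric_group P"
    using Y by (auto simp: rational_points_def toric_points_def)
  have "frobenius P x \<in> Y" using Y Q by (auto simp: rational_points_def)
  then obtain a b where a: "a \<in> toric_group P" "x = act P a y"
     and b: "b \<in> toric_group P" "frobenius P x = act P b y"
    using y Q by auto
  define t where "t F = b F / a F" for F
  have a0: "a F \<noteq> 0" and b0: "b F \<noteq> 0" if "F \<in> facets P" for F
    using a b that by (auto simp: toric_group_def PiE_iff)
  have t0: "t F \<noteq> 0" if "F \<in> facets P" for F
    using a0 b0 that by (simp add: t_def)
  have tprod: "(\<Prod>F\<in>facets P. t F powi (?u F $ j)) = 1" for j
    using a b by (simp add: t_def power_int_divide_distrib prod_dividef toric_group_def)
  have xt: "x F ^ CARD('k) = t F * x F" if "F \<in> facets P" for F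
  proof -
    have "x F = a F * y F" using a(2) that by (simp add: act_def)
    moreover have "x F ^ CARD('k) = b F * y F"
      using fun_cong[OF b(2), of F] that by (simp add: act_def frobenius_def)
    ultimately show ?thesis using a0 that by (simp add: t_def)
  qed
  have t1: "t F = 1" if "F \<in> facets P" "v \<notin> F" for F
    using xt[of F] x1[of F] that by simp
  have chi: "mpol_eval x (chi P \<alpha> m) \<in> range to_ac" if m: "m \<in> lattice_points P" for m
  proof -
    let ?e = "\<lambda>F. idot m (?u F) + \<alpha> F"
    have pos: "?e F \<ge> 0" if "F \<in> facets P" for F
    proof -
      have "rvec m \<bullet> rvec (?u F) \<ge> - real_of_int (\<alpha> F)"
        using \<alpha> m that unfolding facet_offsets_def lattice_points_def by blast
      thus ?thesis unfolding rvec_inner by linarith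
    qed
    have tF: "t F ^ nat (?e F) = t F powi idot (m - w) (?u F)" if "F \<in> facets P" for F
    proof (cases "v \<in> F")
      case True
      have "rvec w \<bullet> rvec (?u F) = - real_of_int (\<alpha> F)"
        using \<alpha> True that unfolding facet_offsets_def w by blast
      hence "\<alpha> F = - idot w (?u F)" unfolding rvec_inner by linarith
      hence "idot (m - w) (?u F) = ?e F"
        by (simp add: idot_def left_diff_distrib sum_subtractf)
      thus ?thesis using pos[OF that] by (simp add: power_int_def)
    next
      case False
      thus ?thesis using t1 that by simp
    qed
    have powi_sum: "t F powi (\<Sum>j\<in>A. g j) = (\<Prod>j\<in>A. t F powi g j)"
      if "F \<in> facets P" "finite A" for F and A :: "'n set" and g
      using that(2) by (induction A rule: finite_induct) (simp_all add: power_int_add t0 that(1))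
    have powi_prod: "(\<Prod>F\<in>A. g F) powi z = (\<Prod>F\<in>A. g F powi z)"
      for A :: "(real ^ 'n) set set" and g :: "_ \<Rightarrow> 'k alg_closure" and z
      by (induction A rule: infinite_finite_induct) (simp_all add: power_int_mult_distrib)
    have "(\<Prod>F\<in>facets P. t F ^ nat (?e F)) =
        (\<Prod>F\<in>facets P. \<Prod>j\<in>UNIV. t F powi ((m - w) $ j * ?u F $ j))"
      by (intro prod.cong refl) (simp add: tF, simp add: idot_def powi_sum)
    also have "\<dots> = (\<Prod>j\<in>UNIV. \<Prod>F\<in>facets P. t F powi ((m - w) $ j * ?u F $ j))"
      by (rule prod.swap)
    also have "\<dots> = (\<Prod>j\<in>UNIV. (\<Prod>F\<in>facets P. t F powi (?u F $ j)) powi ((m - w) $ j))"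
      by (simp only: powi_prod mult.commute[of "(m - w) $ _"] power_int_mult)
    also have "\<dots> = 1" by (simp add: tprod)
    finally have t_one: "(\<Prod>F\<in>facets P. t F ^ nat (?e F)) = 1" .
    have "mpol_eval x (chi P \<alpha> m) ^ CARD('k) = (\<Prod>F\<in>facets P. (x F ^ CARD('k)) ^ nat (?e F))"
      unfolding mpol_eval_chi[OF fin] by (simp add: prod_power_distrib mult.commute flip: power_mult)
    also have "\<dots> = (\<Prod>F\<in>facets P. t F ^ nat (?e F) * x F ^ nat (?e F))"
      by (intro prod.cong refl) (simp add: xt power_mult_distrib)
    also have "\<dots> = mpol_eval x (chi P \<alpha> m)"
      by (simp add: prod.distrib t_one mpol_eval_chi[OF fin])
    finally show ?thesis by (rule frobenius_fixed_in_range)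
  qed
  show ?thesis using f unfolding L_space_def
  proof (induction rule: mpol.span_induct_alt)
    case base
    show ?case using rangeI[of to_ac 0] by (simp add: mpol_eval_0)
  next
    case (step c g h)
    then obtain r s where "mpol_eval x g = to_ac r" "mpol_eval x h = to_ac s"
      using chi by blast
    thus ?case using rangeI[of to_ac "c * r + s"] by (simp add: mpol_eval_add mpol_eval_scale)
  qed
qed

end

theory Submission
  imports Defs
begin

text \<open>
  A representative \<open>x\<close> of a rational point satisfies \<open>x\<^sup>q = t \<cdot> x\<close> with \<open>t\<close> in the group, so
  moving \<open>m\<close> by \<open>(q - 1) z\<close> within the interior of a face multiplies the monomial by
  \<open>\<Prod>\<^sub>F t\<^sub>F powi \<langle>z, u\<^sub>F\<rangle> = 1\<close>; equivalent lattice points thus have equal evaluations.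

  For the independence of the reduced monomials, restrict a vanishing combination to the stratum of a
  face \<open>Q\<close> that is minimal among the faces carrying a nonzero coefficient: only the exponents in
  \<open>Q\<^sup>\<circ>\<close> survive. Every \<open>s\<close> in the split torus \<open>(k\<^sup>*)\<^sup>N\<close> gives a rational
  point of this stratum, at which the monomial of \<open>m\<close> is a nonzero constant independent of \<open>m\<close>
  times \<open>s\<^sup>m\<close>. The characters \<open>s \<mapsto> s\<^sup>m\<close> are distinct for exponents that are distinct
  modulo \<open>q - 1\<close>, hence linearly independent.
\<close>

unbundle no fps_syntax

section \<open>Surjectivity of monomial maps between tori\<close>

lemma integer_adjugate:
  fixes A :: "int ^ 'n ^ 'n"
  assumes "det A \<noteq> 0"
  shows "\<exists>B :: int ^ 'n ^ 'n. A ** B = mat (det A)"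
proof -
  let ?r = "real_of_int"
  \<comment> \<open>\<open>D k i\<close> is the determinant from Cramer's rule: column
    \<open>k\<close> of \<open>A\<close> is replaced by the \<open>i\<close>-th unit vector. It is
    an integer, while the rule itself is applied over the reals, where \<open>det A\<close> can be
    divided out.\<close>
  define D where "D = (\<lambda>k i. det (\<chi> a b. if b = k then (if a = i then 1 else 0) else A $ a $ b))"
  define A' where "A' = (\<chi> a b. ?r (A $ a $ b))"
  have det_int: "det (\<chi> a b. ?r (M a b)) = ?r (det (\<chi> a b. M a b))" for M :: "'n \<Rightarrow> 'n \<Rightarrow> int"
    by (simp add: det_def)
  have dA: "det A' = ?r (det A)"
    using det_int[of "\<lambda>a b. A $ a $ b"] by (simp add: A'_def)
  have "(\<Sum>k\<in>UNIV. A $ a $ k * D k i) = (if a = i then det A else 0)" for a i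
  proof -
    let ?b = "axis i 1 :: real ^ 'n"
    define x where "x = (\<chi> k. det (\<chi> c b. if b = k then ?b $ c else A' $ c $ b) / det A')"
    have "A' *v x = ?b" using cramer[of A' x ?b] assms dA x_def by simp
    moreover have "x $ k = ?r (D k i) / ?r (det A)" for k
    proof -
      have "(\<chi> c b. if b = k then ?b $ c else A' $ c $ b) =
            (\<chi> c b. ?r (if b = k then (if c = i then 1 else 0) else A $ c $ b))"
        by (auto simp: vec_eq_iff axis_def A'_def)
      thus ?thesis by (simp add: x_def dA D_def det_int)
    qed
    ultimately have "(\<Sum>k\<in>UNIV. ?r (A $ a $ k) * (?r (D k i) / ?r (det A))) = (if a = i then 1 else 0)"
      by (auto simp: vec_eq_iff matrix_vector_mult_def A'_def axis_def)
    hence "(\<Sum>k\<in>UNIV. ?r (A $ a $ k) * ?r (D k i)) = (if a = i then ?r (det A) else 0)"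
      using assms by (simp add: sum_divide_distrib[symmetric] field_simps split: if_splits)
    hence "?r (\<Sum>k\<in>UNIV. A $ a $ k * D k i) = ?r (if a = i then det A else 0)"
      by simp
    thus ?thesis using of_int_eq_iff by blast
  qed
  hence "A ** (\<chi> k i. D k i) = mat (det A)"
    by (simp add: vec_eq_iff matrix_matrix_mult_def mat_def)
  thus ?thesis by blast
qed

lemma power_int_sum:
  fixes x :: "'a::field"
  assumes "x \<noteq> 0"
  shows "x powi (\<Sum>i\<in>A. f i) = (\<Prod>i\<in>A. x powi f i)"
  by (induction A rule: infinite_finite_induct) (use assms in \<open>simp_all add: power_int_add\<close>)

lemma prod_power_int:
  fixes f :: "'i \<Rightarrow> 'a::field"
  shows "(\<Prod>i\<in>A. f i) powi z = (\<Prod>i\<in>A. f i powi z)"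
  by (induction A rule: infinite_finite_induct) (simp_all add: power_int_mult_distrib)

lemma to_ac_power_int: "to_ac (x powi z) = to_ac x powi z"
  by (simp add: power_int_def)

lemma alg_closed_ex_powi:
  fixes a :: "'a::alg_closed_field"
  assumes "d \<noteq> 0" "a \<noteq> 0"
  shows "\<exists>y. y \<noteq> 0 \<and> y powi d = a"
proof -
  obtain y where y: "y ^ nat \<bar>d\<bar> = a"
    using nth_root_exists[of "nat \<bar>d\<bar>" a] assms by auto
  hence [simp]: "y \<noteq> 0" using assms by (auto simp: zero_power)
  show ?thesis
  proof (cases "d > 0")
    case True
    thus ?thesis using y by (intro exI[of _ y]) (auto simp: power_int_def)
  next
    case False
    thus ?thesis using y assms
      by (intro exI[of _ "inverse y"]) (auto simp: power_int_def)
  qed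
qed

text \<open>For an integer matrix \<open>B\<close> with
  \<open>transpose A ** B = mat (det A)\<close>, substituting the monomials with exponents
  \<open>B\<close> turns the map into \<open>y \<mapsto> y powi det A\<close> in each coordinate,
  and nonzero elements have roots of every nonzero degree.\<close>

lemma monomial_map_surj:
  fixes A :: "int ^ 'n ^ 'n" and s :: "'n \<Rightarrow> 'a::alg_closed_field"
  assumes "det A \<noteq> 0" and s: "\<And>j. s j \<noteq> 0"
  shows "\<exists>x. (\<forall>i. x i \<noteq> 0) \<and> (\<forall>j. (\<Prod>i\<in>UNIV. x i powi (A $ i $ j)) = s j)"
proof -
  obtain B :: "int ^ 'n ^ 'n" where B: "transpose A ** B = mat (det A)"
    using integer_adjugate[of "transpose A"] assms(1) by (auto simp: det_transpose)
  have "\<forall>j. \<exists>y. y \<noteq> 0 \<and> y powi det A = s j"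
    using alg_closed_ex_powi assms by blast
  then obtain y where y: "\<And>j. y j \<noteq> 0" "\<And>j. y j powi det A = s j" by metis
  define x where "x i = (\<Prod>k\<in>UNIV. y k powi (B $ i $ k))" for i
  have "(\<Prod>i\<in>UNIV. x i powi (A $ i $ j)) = s j" for j
  proof -
    have AB: "(\<Sum>i\<in>UNIV. B $ i $ k * A $ i $ j) = (if j = k then det A else 0)" for k
      using B by (simp add: vec_eq_iff matrix_matrix_mult_def mat_def transpose_def mult.commute)
    have "(\<Prod>i\<in>UNIV. x i powi (A $ i $ j)) = (\<Prod>i\<in>UNIV. \<Prod>k\<in>UNIV. y k powi (B $ i $ k * A $ i $ j))"
      by (simp add: x_def prod_power_int power_int_mult)
    also have "\<dots> = (\<Prod>k\<in>UNIV. y k powi (\<Sum>i\<in>UNIV. B $ i $ k * A $ i $ j))"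
      by (subst prod.swap) (simp add: power_int_sum y)
    also have "\<dots> = (\<Prod>k\<in>UNIV. if j = k then s k else 1)"
      unfolding AB by (intro prod.cong) (auto simp: y)
    finally show ?thesis by simp
  qed
  thus ?thesis using y by (intro exI[of _ x]) (auto simp: x_def)
qed

section \<open>Characters and their separation by elements of a finite field\<close>

text \<open>Artin's argument: eliminate one character at a time.\<close>

lemma multiplicative_functions_independent:
  fixes ch :: "'i \<Rightarrow> 'x \<Rightarrow> 'a::field"
  assumes "finite I"
    and closed: "\<And>x y. x \<in> U \<Longrightarrow> y \<in> U \<Longrightarrow> f x y \<in> U"
    and mult: "\<And>i x y. i \<in> I \<Longrightarrow> x \<in> U \<Longrightarrow> y \<in> U \<Longrightarrow> ch i (f x y) = ch i x * ch i y"
    and nz: "\<And>i. i \<in> I \<Longrightarrow> \<exists>x\<in>U. ch i x \<noteq> 0"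
    and distinct: "\<And>i j. i \<in> I \<Longrightarrow> j \<in> I \<Longrightarrow> i \<noteq> j \<Longrightarrow> \<exists>x\<in>U. ch i x \<noteq> ch j x"
    and zero: "\<And>x. x \<in> U \<Longrightarrow> (\<Sum>i\<in>I. c i * ch i x) = 0"
    and "i \<in> I"
  shows "c i = 0"
  using assms(1,3-)
proof (induction I arbitrary: c i rule: finite_induct)
  case (insert k I)
  have c0: "c j = 0" if j: "j \<in> I" for j
  proof -
    obtain y where y: "y \<in> U" "ch j y \<noteq> ch k y"
      using insert.prems(3)[of j k] insert.hyps j by blast
    have "c j * (ch j y - ch k y) = 0"
    proof (rule insert.IH[OF _ _ _ _ j])
      fix x assume x: "x \<in> U"
      \<comment> \<open>The relation at \<open>f y x\<close> minus \<open>ch k y\<close> times the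
        relation at \<open>x\<close> has no term for \<open>k\<close>, while the coefficient of
        \<open>j\<close> picks up the nonzero factor \<open>ch j y - ch k y\<close>.\<close>
      have "0 = (\<Sum>i\<in>insert k I. c i * ch i (f y x)) - ch k y * (\<Sum>i\<in>insert k I. c i * ch i x)"
        using insert.prems(4) closed x y by simp
      also have "\<dots> = (\<Sum>i\<in>insert k I. c i * (ch i y - ch k y) * ch i x)"
        unfolding sum_distrib_left sum_subtractf[symmetric]
        by (intro sum.cong) (auto simp: insert.prems(1) x y algebra_simps)
      finally show "(\<Sum>i\<in>I. c i * (ch i y - ch k y) * ch i x) = 0"
        using insert.hyps by simp
    qed (use insert.prems in auto)
    thus ?thesis using y by simp
  qed
  obtain x where x: "x \<in> U" "ch k x \<noteq> 0" using insert.prems(2) by blast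
  have "c k = 0" using insert.prems(4)[OF x(1)] x insert.hyps c0 by simp
  thus ?case using c0 insert.prems(5) by blast
qed simp

text \<open>Otherwise all \<open>CARD('k) - 1\<close> nonzero elements would be roots of
  \<open>X^n - 1\<close>, where \<open>n\<close> is the remainder of \<open>z\<close> modulo
  \<open>CARD('k) - 1\<close>; but \<open>n\<close> is positive and smaller than their
  number.\<close>

lemma finite_field_ex_power_neq_1:
  assumes "\<not> (int CARD('k::{field,finite}) - 1) dvd z"
  shows "\<exists>a::'k. a \<noteq> 0 \<and> a powi z \<noteq> 1"
proof (rule ccontr)
  assume none: "\<not> ?thesis"
  let ?d = "int CARD('k) - 1"
  have card: "CARD('k) > 1"
    using card_mono[of "UNIV :: 'k set" "{0, 1}"] by simp
  have pow_d: "a powi ?d = 1" if "a \<noteq> 0" for a :: 'k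
    using finite_field_power_card_eq[of a] that
    by (simp add: power_int_diff)
  define n where "n = nat (z mod ?d)"
  have "z mod ?d \<noteq> 0" "0 \<le> z mod ?d" "z mod ?d < ?d"
    using assms card by (simp_all add: dvd_eq_mod_eq_0)
  hence n: "n > 0" "n < CARD('k) - 1"
    by (auto simp: n_def)
  have "a ^ n = 1" if "a \<noteq> 0" for a :: 'k
  proof -
    have "a powi z = a powi (?d * (z div ?d) + z mod ?d)" by simp
    also have "\<dots> = a powi (z mod ?d)"
      using that pow_d[OF that] by (subst power_int_add) (simp_all add: power_int_mult)
    finally show ?thesis using none that n by (auto simp: n_def power_int_def split: if_splits)
  qed
  moreover define p :: "'k poly" where "p = Polynomial.monom 1 n - 1"
  ultimately have sub: "- {0} \<subseteq> {a. poly p a = 0}" by (auto simp: poly_monom)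
  have deg: "Polynomial.degree p \<le> n"
    unfolding p_def by (intro degree_diff_le degree_monom_le) simp
  have "Polynomial.coeff p n = 1" using n by (simp add: p_def)
  hence p0: "p \<noteq> 0" by auto
  have "CARD('k) - 1 \<le> card {a. poly p a = 0}"
    using card_mono[OF _ sub] by (simp add: Compl_eq_Diff_UNIV card_Diff_singleton)
  also have "\<dots> \<le> n"
    using card_poly_roots_bound[OF p0] deg by simp
  finally show False using n by simp
qed

section \<open>Faces, the toric group and the Frobenius map\<close>

lemma face_interior_subset:
  assumes "convex P" "Q face_of P" "G face_of P" "x \<in> face_interior Q" "x \<in> G"
  shows "Q \<subseteq> G"
proof -
  \<comment> \<open>No proper face of \<open>Q\<close> meets \<open>face_interior Q\<close>, so this
    face, which contains \<open>x\<close>, is \<open>Q\<close> itself.\<close>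
  have "(G \<inter> Q) face_of Q"
    by (rule face_of_subset[OF face_of_Int[OF assms(3,2)]])
      (use face_of_imp_subset[OF assms(2)] in auto)
  thus ?thesis using assms(4,5) by (auto simp: face_interior_def)
qed

lemma prod_powi_idot:
  fixes t :: "'i \<Rightarrow> 'a::field"
  assumes "\<And>F. F \<in> A \<Longrightarrow> t F \<noteq> 0"
  shows "(\<Prod>F\<in>A. t F powi idot m (u F)) = (\<Prod>j\<in>UNIV. (\<Prod>F\<in>A. t F powi (u F $ j)) powi (m $ j))"
proof -
  have "(\<Prod>F\<in>A. t F powi idot m (u F)) = (\<Prod>F\<in>A. \<Prod>j\<in>UNIV. t F powi (u F $ j * m $ j))"
    using assms by (intro prod.cong refl) (simp add: idot_def power_int_sum mult.commute)
  also have "\<dots> = (\<Prod>j\<in>UNIV. \<Prod>F\<in>A. t F powi (u F $ j * m $ j))"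
    by (rule prod.swap)
  finally show ?thesis by (simp add: prod_power_int power_int_mult)
qed

text \<open>The equations that define the group are this identity for the unit vectors; a general
  \<open>m\<close> multiplies powers of them.\<close>

lemma toric_group_monomial:
  assumes "t \<in> toric_group P"
  shows "(\<Prod>F\<in>facets P. t F powi idot m (facet_normal P F)) = 1"
  using assms by (subst prod_powi_idot) (auto simp: toric_group_def PiE_iff)

text \<open>If \<open>a\<close> and \<open>b\<close> carry a point \<open>y\<close> of the orbit to
  \<open>x\<close> and to the Frobenius image of \<open>x\<close>, then \<open>t\<close> is the
  quotient \<open>b / a\<close>.\<close>

lemma rational_point_frobenius:
  fixes x :: "('n::finite, 'k::{field,finite}) coords"
  assumes "Y \<in> rational_points P" "x \<in> Y"
  shows "\<exists>t\<in>toric_group P. \<forall>F\<in>facets P. x F ^ CARD('k) = t F * x F"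
proof -
  obtain y where y: "Y = (\<lambda>t. act P t y) ` toric_group P"
    using assms by (auto simp: rational_points_def toric_points_def)
  have "frobenius P x \<in> Y" using assms by (auto simp: rational_points_def)
  then obtain a b where a: "a \<in> toric_group P" "x = act P a y"
     and b: "b \<in> toric_group P" "frobenius P x = act P b y"
    using y assms by auto
  define t where "t = (\<lambda>F\<in>facets P. b F / a F)"
  have nz: "a F \<noteq> 0" "b F \<noteq> 0" if "F \<in> facets P" for F
    using a b that by (auto simp: toric_group_def PiE_iff)
  have "t \<in> toric_group P"
    using a b nz by (auto simp: t_def power_int_divide_distrib prod_dividef toric_group_def)
  moreover have "x F ^ CARD('k) = t F * x F" if "F \<in> facets P" for F
    using fun_cong[OF b(2), of F] a nz that by (simp add: act_def frobenius_def t_def)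
  ultimately show ?thesis by blast
qed

section \<open>Facet normals and faces of the polytope\<close>

locale projective_toric_code =
  fixes P :: "(real ^ 'n) set"
    and \<alpha> :: "(real ^ 'n) set \<Rightarrow> int"
    and S :: "('n, 'k::{field,finite}) coords set"
    and R :: "(int ^ 'n) set"
  assumes lattice: "lattice_polytope P"
    and full_dim: "aff_dim P = int CARD('n)"
    and simple: "simple_polytope P"
    and dets: "vertex_dets_coprime CHAR('k) P"
    and offsets: "facet_offsets P \<alpha>"
    and reps: "normalized_rep_system P S"
    and red: "projective_reduction CARD('k) P R"
begin

abbreviation \<nu> where "\<nu> \<equiv> facet_normal P"
abbreviation "expo m F \<equiv> idot m (\<nu> F) + \<alpha> F"

lemma polytope: "polytope P"
  using lattice by (auto simp: lattice_polytope_def polytope_def)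

lemma finite_facets: "finite (facets P)"
  using polytope by (auto simp: facets_def finite_polytope_facets)

lemma card_field: "CARD('k) > 1"
  using card_mono[of "UNIV :: 'k set" "{0, 1}"] by simp

lemma face_has_vertex:
  assumes "Q face_of P" "Q \<noteq> {}"
  shows "\<exists>v. v \<in> vertices Q \<and> v \<in> vertices P \<and> v \<in> Q"
proof -
  have Q: "polytope Q" using polytope assms(1) by (rule face_of_polytope_polytope)
  obtain v where "v extreme_point_of Q"
    using extreme_point_exists_convex[OF polytope_imp_compact[OF Q] polytope_imp_convex[OF Q] assms(2)] by blast
  thus ?thesis using extreme_point_of_face[OF assms(1)] by (auto simp: vertices_def)
qed

text \<open>Simplicity supplies as many facets through \<open>v\<close> as the matrix has rows. A
  zero determinant is coprime only to units, and the characteristic of a field is never 1.\<close>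

lemma vertex_normals:
  assumes "v \<in> vertices P"
  shows "\<exists>\<sigma>. bij_betw \<sigma> (UNIV :: 'n set) {F \<in> facets P. v \<in> F} \<and> det (\<chi> i. \<nu> (\<sigma> i)) \<noteq> 0"
proof -
  have "card {F \<in> facets P. v \<in> F} = CARD('n)"
    using simple assms by (auto simp: simple_polytope_def)
  then obtain \<sigma> where \<sigma>: "bij_betw \<sigma> (UNIV :: 'n set) {F \<in> facets P. v \<in> F}"
    using finite_same_card_bij[of "UNIV :: 'n set" "{F \<in> facets P. v \<in> F}"] finite_facets by auto
  hence "coprime (det (\<chi> i. \<nu> (\<sigma> i))) (int CHAR('k))"
    using dets assms by (auto simp: vertex_dets_coprime_def)
  thus ?thesis using \<sigma> by (intro exI[of _ \<sigma>]) auto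
qed

text \<open>A zero normal would be a zero row in the nonsingular matrix of a vertex of
  \<open>F\<close>; this avoids the question whether the minimum in \<open>facet_normal\<close> is
  attained.\<close>

lemma normal_nonzero:
  assumes "F \<in> facets P"
  shows "\<nu> F \<noteq> 0"
proof
  assume 0: "\<nu> F = 0"
  obtain v where v: "v \<in> vertices P" "v \<in> F"
    using face_has_vertex assms unfolding facets_def facet_of_def by blast
  obtain \<sigma> where \<sigma>: "bij_betw \<sigma> (UNIV :: 'n set) {F \<in> facets P. v \<in> F}"
    "det (\<chi> i. \<nu> (\<sigma> i)) \<noteq> 0" using vertex_normals v by blast
  have "F \<in> range \<sigma>" using bij_betw_imp_surj_on[OF \<sigma>(1)] assms v by simp
  then obtain i where "\<sigma> i = F" by auto
  hence "row i (\<chi> i. \<nu> (\<sigma> i)) = 0" by (simp add: row_def 0 vec_eq_iff)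
  thus False using \<sigma> det_zero_row by blast
qed

lemma expo_nonneg:
  assumes "m \<in> lattice_points P" "F \<in> facets P"
  shows "expo m F \<ge> 0"
proof -
  have "rvec m \<bullet> rvec (\<nu> F) \<ge> - real_of_int (\<alpha> F)"
    using offsets assms unfolding facet_offsets_def lattice_points_def by blast
  thus ?thesis unfolding rvec_inner by linarith
qed

text \<open>The supporting hyperplane cuts \<open>P\<close> in a convex set of dimension at most
  \<open>CARD('n) - 1\<close>. The facet is a face of this section and already has that dimension,
  hence is all of it.\<close>

lemma expo_eq_0_iff:
  assumes "m \<in> lattice_points P" "F \<in> facets P"
  shows "expo m F = 0 \<longleftrightarrow> rvec m \<in> F"
proof -
  let ?u = "rvec (\<nu> F)" and ?b = "- real_of_int (\<alpha> F)"
  let ?G = "P \<inter> {x. ?u \<bullet> x = ?b}"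
  have "rvec (\<nu> F) \<noteq> 0"
    using normal_nonzero[OF assms(2)] by (auto simp: rvec_def vec_eq_iff)
  hence "aff_dim {x. ?u \<bullet> x = ?b} = int CARD('n) - 1"
    by (simp add: aff_dim_hyperplane)
  hence dim_G: "aff_dim ?G \<le> int CARD('n) - 1"
    using aff_dim_subset[of ?G "{x. ?u \<bullet> x = ?b}"] by simp
  have facet: "F face_of P" "aff_dim F = int CARD('n) - 1"
    using assms(2) full_dim by (auto simp: facets_def facet_of_def)
  have "F \<subseteq> ?G" using offsets assms(2) face_of_imp_subset[OF facet(1)]
    unfolding facet_offsets_def by (auto simp: inner_commute)
  hence "F face_of ?G" by (rule face_of_subset[OF facet(1)]) simp
  moreover have "convex ?G"
    using polytope_imp_convex[OF polytope] by (intro convex_Int convex_hyperplane)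
  ultimately have "F = ?G"
    using face_of_aff_dim_lt[of ?G F] dim_G facet(2) by auto
  hence "rvec m \<in> F \<longleftrightarrow> rvec m \<bullet> ?u = ?b"
    using assms(1) by (auto simp: lattice_points_def inner_commute)
  thus ?thesis by (auto simp: rvec_inner)
qed

text \<open>A proper nonempty face of a polyhedron is the intersection of the facets that contain
  it.\<close>

lemma mem_face_if_mem_facets:
  assumes "Q face_of P" "Q \<noteq> {}" "x \<in> P" "\<And>F. F \<in> facets P \<Longrightarrow> Q \<subseteq> F \<Longrightarrow> x \<in> F"
  shows "x \<in> Q"
proof (cases "Q = P")
  case False
  show ?thesis
    by (subst face_of_polyhedron[OF polytope_imp_polyhedron[OF polytope] assms(1,2) False])
       (use assms(4) in \<open>auto simp: facets_def\<close>)
qed (use assms in auto)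

section \<open>Monomials at rational points\<close>

lemma mpol_eval_chi_powi:
  assumes "m \<in> lattice_points P"
  shows "mpol_eval x (chi P \<alpha> m) = (\<Prod>F\<in>facets P. x F powi expo m F)"
  unfolding mpol_eval_chi[OF finite_facets]
  using expo_nonneg[OF assms] by (intro prod.cong) (auto simp: power_int_def)

text \<open>Because \<open>0 powi 0 = 1\<close>, a zero coordinate annihilates the monomial only if
  its exponent is nonzero, that is, if the lattice point is off the facet.\<close>

lemma mpol_eval_chi_eq_0_iff:
  assumes "m \<in> lattice_points P"
  shows "mpol_eval x (chi P \<alpha> m) = 0 \<longleftrightarrow> (\<exists>F\<in>facets P. x F = 0 \<and> rvec m \<notin> F)"
  unfolding mpol_eval_chi_powi[OF assms] using finite_facets expo_eq_0_iff[OF assms] by auto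

lemma proj_equiv_mpol_eval:
  assumes Y: "Y \<in> rational_points P" "x \<in> Y"
    and m: "m \<in> lattice_points P" "m' \<in> lattice_points P" "proj_equiv CARD('k) P m m'"
  shows "mpol_eval x (chi P \<alpha> m) = mpol_eval (x :: ('n, 'k) coords) (chi P \<alpha> m')"
proof -
  obtain Q where Q: "Q face_of P" "rvec m \<in> face_interior Q" "rvec m' \<in> face_interior Q"
    using m(3) by (auto simp: proj_equiv_def)
  obtain z where z: "\<And>j. (m - m') $ j = (int CARD('k) - 1) * z $ j"
    using m(3) by (auto simp: proj_equiv_def)
  \<comment> \<open>A facet containing one interior point of \<open>Q\<close> contains all of
    \<open>Q\<close>, so both monomials vanish at the same points.\<close>
  have same: "rvec m \<in> F \<longleftrightarrow> rvec m' \<in> F" if "F \<in> facets P" for F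
    using face_interior_subset[OF polytope_imp_convex[OF polytope] Q(1), of F] Q that
    by (auto simp: facets_def facet_of_def face_interior_def)
  show ?thesis
  proof (cases "\<exists>F\<in>facets P. x F = 0 \<and> rvec m \<notin> F")
    case True
    hence "mpol_eval x (chi P \<alpha> m) = 0" "mpol_eval x (chi P \<alpha> m') = 0"
      using same mpol_eval_chi_eq_0_iff m by blast+
    thus ?thesis by simp
  next
    case False
    obtain t where t: "t \<in> toric_group P" "\<And>F. F \<in> facets P \<Longrightarrow> x F ^ CARD('k) = t F * x F"
      using rational_point_frobenius[OF Y] by blast
    have expo: "expo m F = expo m' F + (int CARD('k) - 1) * idot z (\<nu> F)" for F
    proof -
      have "idot m (\<nu> F) - idot m' (\<nu> F) = (\<Sum>j\<in>UNIV. (m - m') $ j * \<nu> F $ j)"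
        by (simp add: idot_def left_diff_distrib sum_subtractf)
      also have "\<dots> = (int CARD('k) - 1) * idot z (\<nu> F)"
        unfolding z by (simp add: idot_def sum_distrib_left mult.assoc)
      finally show ?thesis by simp
    qed
    have "x F powi expo m F = x F powi expo m' F * t F powi idot z (\<nu> F)"
      if F: "F \<in> facets P" for F
    proof (cases "x F = 0")
      \<comment> \<open>Here \<open>x F\<close> does not determine \<open>t F\<close>. Both
        exponents are 0, hence so is \<open>idot z (\<nu> F)\<close>, because
        \<open>CARD('k) - 1\<close> is nonzero, and \<open>t F\<close> contributes the factor
        1.\<close>
      case True
      hence "expo m F = 0" "expo m' F = 0"
        using False F same expo_eq_0_iff m by blast+
      thus ?thesis using expo[of F] card_field by simp
    next
      case nz: False
      have "x F powi (int CARD('k) - 1) = t F"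
        using t(2)[OF F] nz by (simp add: power_int_diff)
      thus ?thesis unfolding expo using nz by (simp add: power_int_add power_int_mult)
    qed
    thus ?thesis
      using m toric_group_monomial[OF t(1)] by (simp add: mpol_eval_chi_powi prod.distrib)
  qed
qed

section \<open>Rational points on the stratum of a face\<close>

lemma normal_map_surj:
  fixes s :: "'n \<Rightarrow> 'k alg_closure"
  assumes "\<And>j. s j \<noteq> 0"
  shows "\<exists>y. (\<forall>F. y F \<noteq> 0) \<and> (\<forall>j. (\<Prod>F\<in>facets P. y F powi (\<nu> F $ j)) = s j)"
proof -
  have "P \<noteq> {}" using full_dim by auto
  then obtain v where "v \<in> vertices P"
    using face_has_vertex[of P] polytope_imp_convex[OF polytope] face_of_refl by blast
  then obtain \<sigma> where \<sigma>: "bij_betw \<sigma> (UNIV :: 'n set) {F \<in> facets P. v \<in> F}"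
    "det (\<chi> i. \<nu> (\<sigma> i)) \<noteq> 0" using vertex_normals by blast
  obtain x where x: "\<And>i. x i \<noteq> 0" "\<And>j. (\<Prod>i\<in>UNIV. x i powi (\<nu> (\<sigma> i) $ j)) = s j"
    using monomial_map_surj[where s = s, OF \<sigma>(2) assms] by auto
  \<comment> \<open>With coordinates 1 off \<open>v\<close>, only the facets through
    \<open>v\<close> contribute, and their exponent matrix is nonsingular.\<close>
  define y where "y F = (if v \<in> F then x (the_inv_into UNIV \<sigma> F) else 1)" for F
  have "(\<Prod>F\<in>facets P. y F powi (\<nu> F $ j)) = s j" for j
  proof -
    have "(\<Prod>F\<in>facets P. y F powi (\<nu> F $ j)) =
          (\<Prod>F\<in>{F \<in> facets P. v \<in> F}. y F powi (\<nu> F $ j))"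
      using finite_facets by (intro prod.mono_neutral_right) (auto simp: y_def)
    also have "\<dots> = (\<Prod>i\<in>UNIV. y (\<sigma> i) powi (\<nu> (\<sigma> i) $ j))"
      using prod.reindex_bij_betw[OF \<sigma>(1), symmetric] .
    also have "\<dots> = (\<Prod>i\<in>UNIV. x i powi (\<nu> (\<sigma> i) $ j))"
    proof (intro prod.cong refl)
      fix i
      have "the_inv_into UNIV \<sigma> (\<sigma> i) = i" "v \<in> \<sigma> i"
        using \<sigma>(1) by (auto simp: bij_betw_def the_inv_into_f_f)
      thus "y (\<sigma> i) powi (\<nu> (\<sigma> i) $ j) = x i powi (\<nu> (\<sigma> i) $ j)"
        by (simp add: y_def)
    qed
    finally show ?thesis using x by simp
  qed
  moreover have "y F \<noteq> 0" for F using x by (simp add: y_def)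
  ultimately show ?thesis by blast
qed

text \<open>
  The tuple \<open>y\<close> with \<open>\<Prod>\<^sub>F y\<^sub>F powi u\<^sub>F\<^sub>j = s\<^sub>j\<close> may lie outside the base field, but its Frobenius
  image is \<open>y\<close> times the tuple \<open>(y\<^sub>F ^ (q - 1))\<close>, which belongs to the group because \<open>s\<^sub>j ^ (q - 1) = 1\<close>.
\<close>

lemma evaluation_point_on_face:
  fixes s :: "'n \<Rightarrow> 'k"
  assumes s: "\<And>j. s j \<noteq> 0" and Q: "Q face_of P" "Q \<noteq> {}"
  shows "\<exists>x\<in>S. \<exists>C. C \<noteq> 0 \<and> (\<forall>m\<in>lattice_points P. mpol_eval x (chi P \<alpha> m) =
    (if rvec m \<in> Q then C * (\<Prod>j\<in>UNIV. to_ac (s j) powi (m $ j)) else 0))"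
proof -
  obtain y where y: "\<And>F. y F \<noteq> 0"
    "\<And>j. (\<Prod>F\<in>facets P. y F powi (\<nu> F $ j)) = to_ac (s j)"
    using normal_map_surj[of "\<lambda>j. to_ac (s j)"] s by auto
  define y0 where "y0 = (\<lambda>F\<in>facets P. if Q \<subseteq> F then 0 else y F)"
  define Y where "Y = (\<lambda>t. act P t y0) ` toric_group P"
  \<comment> \<open>A facet that misses a vertex of \<open>Q\<close> does not contain
    \<open>Q\<close>; thus all coordinates in the product for \<open>v\<close> are nonzero and
    \<open>y0\<close> avoids the irrelevant locus.\<close>
  obtain v where v: "v \<in> vertices P" "v \<in> Q" using face_has_vertex[OF Q] by blast
  have "(\<Prod>F | F \<in> facets P \<and> v \<notin> F. y0 F) \<noteq> 0"
    using v(2) y finite_facets by (auto simp: y0_def)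
  hence "y0 \<in> affine_tuples P - irrelevant_locus P"
    using v(1) by (auto simp: affine_tuples_def irrelevant_locus_def y0_def)
  hence "Y \<in> toric_points P" by (auto simp: toric_points_def Y_def)
  moreover have "frobenius P (act P t y0) \<in> Y" if t: "t \<in> toric_group P" for t
  proof -
    define t' where "t' = (\<lambda>F\<in>facets P. t F ^ CARD('k) * y F ^ (CARD('k) - 1))"
    have "(\<Prod>F\<in>facets P. t' F powi (\<nu> F $ j)) = 1" for j
    proof -
      have "(\<Prod>F\<in>facets P. t' F powi (\<nu> F $ j)) =
        (\<Prod>F\<in>facets P. (t F powi (\<nu> F $ j)) ^ CARD('k) * (y F powi (\<nu> F $ j)) ^ (CARD('k) - 1))"
        by (intro prod.cong refl)
          (simp add: t'_def power_int_mult_distrib power_int_power power_int_power' mult.commute)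
      also have "\<dots> = (\<Prod>F\<in>facets P. t F powi (\<nu> F $ j)) ^ CARD('k) *
          (\<Prod>F\<in>facets P. y F powi (\<nu> F $ j)) ^ (CARD('k) - 1)"
        by (simp only: prod.distrib prod_power_distrib)
      also have "\<dots> = to_ac (s j ^ (CARD('k) - 1))"
        using t by (simp add: y toric_group_def)
      also have "s j ^ (CARD('k) - 1) = 1"
        using finite_field_power_card_eq[of "s j"] s[of j] card_field
        by (simp add: power_diff)
      finally show ?thesis by simp
    qed
    hence "t' \<in> toric_group P"
      using t y by (auto simp: toric_group_def t'_def PiE_iff)
    moreover have "frobenius P (act P t y0) = act P t' y0"
      using card_field
      by (auto simp: frobenius_def act_def y0_def t'_def fun_eq_iff restrict_def
          power_mult_distrib zero_power simp flip: power_Suc2)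
    ultimately show ?thesis by (auto simp: Y_def)
  qed
  ultimately have "Y \<in> rational_points P" by (auto simp: rational_points_def Y_def)
  then obtain x where x: "x \<in> S" "x \<in> Y"
    using reps by (auto simp: normalized_rep_system_def normalized_rep_def)
  then obtain t where t: "t \<in> toric_group P" "x = act P t y0" by (auto simp: Y_def)
  \<comment> \<open>\<open>C\<close> collects the powers coming from the offsets. The powers of
    \<open>t\<close> that depend on \<open>m\<close> have product 1, so the choice of
    \<open>x\<close> within its orbit only affects this constant.\<close>
  define C where "C = (\<Prod>F\<in>facets P. (t F * y F) powi \<alpha> F)"
  have tnz: "t F \<noteq> 0" if "F \<in> facets P" for F using t that by (auto simp: toric_group_def PiE_iff)
  have "mpol_eval x (chi P \<alpha> m) = (if rvec m \<in> Q then C * (\<Prod>j\<in>UNIV. to_ac (s j) powi (m $ j)) else 0)"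
    if m: "m \<in> lattice_points P" for m
  proof (cases "rvec m \<in> Q")
    case True
    have "mpol_eval x (chi P \<alpha> m) = (\<Prod>F\<in>facets P. (t F * y F) powi expo m F)"
      unfolding mpol_eval_chi_powi[OF m]
    proof (intro prod.cong refl)
      fix F assume F: "F \<in> facets P"
      show "x F powi expo m F = (t F * y F) powi expo m F"
      proof (cases "Q \<subseteq> F")
        \<comment> \<open>On these facets \<open>x F\<close> is 0 but its exponent is 0 too, so the
          nonzero base \<open>t F * y F\<close> may replace it.\<close>
        case True
        hence "expo m F = 0" using expo_eq_0_iff[OF m F] \<open>rvec m \<in> Q\<close> by auto
        thus ?thesis by simp
      qed (use F in \<open>simp add: t act_def y0_def\<close>)
    qed
    also have "\<dots> = (\<Prod>F\<in>facets P. t F powi idot m (\<nu> F)) *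
        (\<Prod>F\<in>facets P. y F powi idot m (\<nu> F)) * C"
      unfolding C_def prod.distrib[symmetric] using y tnz
      by (intro prod.cong refl) (simp add: power_int_add power_int_mult_distrib)
    also have "(\<Prod>F\<in>facets P. y F powi idot m (\<nu> F)) = (\<Prod>j\<in>UNIV. to_ac (s j) powi (m $ j))"
      by (subst prod_powi_idot) (simp_all add: y)
    finally show ?thesis using True toric_group_monomial[OF t(1)] by simp
  next
    case False
    then obtain F where F: "F \<in> facets P" "Q \<subseteq> F" "rvec m \<notin> F"
      using mem_face_if_mem_facets[OF Q] m by (auto simp: lattice_points_def)
    hence "x F = 0" by (simp add: t act_def y0_def)
    thus ?thesis using F False mpol_eval_chi_eq_0_iff[OF m] by auto
  qed
  moreover have "C \<noteq> 0" using tnz y finite_facets by (simp add: C_def)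
  ultimately show ?thesis using x by blast
qed

section \<open>Independence of the reduced monomials\<close>

lemma R_subset: "R \<subseteq> lattice_points P"
  using red by (simp add: projective_reduction_def)

text \<open>The face is read off from the equivalence of \<open>m\<close> with its representative in
  \<open>R\<close>.\<close>

lemma lattice_point_in_face_interior:
  assumes "m \<in> lattice_points P"
  shows "\<exists>Q. Q face_of P \<and> rvec m \<in> face_interior Q"
  using red assms unfolding projective_reduction_def proj_equiv_def by blast

lemma reduction_unique:
  assumes "r \<in> R" "r' \<in> R" "proj_equiv CARD('k) P r r'"
  shows "r = r'"
proof -
  \<comment> \<open>Reflexivity at \<open>r'\<close> makes \<open>r\<close> and \<open>r'\<close>
    two representatives of the same lattice point.\<close>
  have "proj_equiv CARD('k) P r' r'"
    using assms(3) by (auto simp: proj_equiv_def intro!: exI[of _ "0 :: int ^ 'n"])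
  thus ?thesis
    using red assms R_subset unfolding projective_reduction_def by blast
qed

lemma reduce_properties:
  assumes "m \<in> lattice_points P"
  shows "reduce CARD('k) P R m \<in> R" "proj_equiv CARD('k) P (reduce CARD('k) P R m) m"
proof -
  have "\<exists>!r. r \<in> R \<and> proj_equiv CARD('k) P r m"
    using red assms by (simp add: projective_reduction_def)
  from theI'[OF this]
  show "reduce CARD('k) P R m \<in> R" "proj_equiv CARD('k) P (reduce CARD('k) P R m) m"
    by (simp_all add: reduce_def)
qed

text \<open>In the interior of one face, exponents that agree modulo \<open>CARD('k) - 1\<close> are
  equivalent. Distinct elements of \<open>R\<close> therefore differ modulo
  \<open>CARD('k) - 1\<close> in some coordinate, where an element of the field separates
  them.\<close>

lemma reduced_characters_independent:
  fixes c :: "int ^ 'n \<Rightarrow> 'k alg_closure"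
  assumes T: "finite T" "T \<subseteq> R" and Q: "Q face_of P" "\<And>r. r \<in> T \<Longrightarrow> rvec r \<in> face_interior Q"
    and zero: "\<And>s :: 'n \<Rightarrow> 'k. (\<And>j. s j \<noteq> 0) \<Longrightarrow>
      (\<Sum>r\<in>T. c r * (\<Prod>j\<in>UNIV. to_ac (s j) powi (r $ j))) = 0"
    and "r \<in> T"
  shows "c r = 0"
proof (rule multiplicative_functions_independent[where U = "{s :: 'n \<Rightarrow> 'k. \<forall>j. s j \<noteq> 0}"
      and f = "\<lambda>s s' j. s j * s' j" and ch = "\<lambda>(r :: int ^ 'n) s. \<Prod>j\<in>UNIV. to_ac (s j) powi (r $ j)"])
  fix r r' assume r: "r \<in> T" "r' \<in> T" "r \<noteq> r'"
  have "\<not> (\<forall>j. \<exists>z. (r - r') $ j = (int CARD('k) - 1) * z)"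
  proof
    assume "\<forall>j. \<exists>z. (r - r') $ j = (int CARD('k) - 1) * z"
    then obtain z where "\<And>j. (r - r') $ j = (int CARD('k) - 1) * z j" by metis
    hence "\<exists>z :: int ^ 'n. \<forall>j. (r - r') $ j = (int CARD('k) - 1) * z $ j"
      by (intro exI[of _ "\<chi> j. z j"]) simp
    moreover have "Q \<noteq> {}" using Q r by (auto simp: face_interior_def)
    ultimately have "proj_equiv CARD('k) P r r'"
      using Q r unfolding proj_equiv_def by blast
    thus False using reduction_unique T r by blast
  qed
  then obtain j where "\<not> (int CARD('k) - 1) dvd (r - r') $ j" by (auto simp: dvd_def)
  then obtain a :: 'k where a: "a \<noteq> 0" "a powi ((r - r') $ j) \<noteq> 1"
    using finite_field_ex_power_neq_1 by blast
  \<comment> \<open>The entry \<open>a\<close> at place \<open>j\<close> and 1 elsewhere reduces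
    both characters to their \<open>j\<close>-th factor.\<close>
  define s where "s i = (if i = j then a else 1)" for i
  have prod_s: "(\<Prod>i\<in>UNIV. to_ac (s i) powi (m $ i)) = to_ac a powi (m $ j)" for m :: "int ^ 'n"
  proof -
    have "(\<Prod>i\<in>UNIV. to_ac (s i) powi (m $ i)) = (\<Prod>i\<in>UNIV. if i = j then to_ac a powi (m $ j) else 1)"
      by (intro prod.cong) (auto simp: s_def)
    thus ?thesis by simp
  qed
  have "a powi (r $ j) \<noteq> a powi (r' $ j)" using a by (auto simp: power_int_diff)
  hence "to_ac (a powi (r $ j)) \<noteq> to_ac (a powi (r' $ j))" using inj_to_ac by (metis injD)
  hence "to_ac a powi (r $ j) \<noteq> to_ac a powi (r' $ j)"
    by (simp add: to_ac_power_int)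
  thus "\<exists>s\<in>{s :: 'n \<Rightarrow> 'k. \<forall>j. s j \<noteq> 0}.
     (\<Prod>j\<in>UNIV. to_ac (s j) powi (r $ j)) \<noteq> (\<Prod>j\<in>UNIV. to_ac (s j) powi (r' $ j))"
    using a by (intro bexI[of _ s]) (auto simp: prod_s, auto simp: s_def split: if_splits)
qed (use assms in \<open>auto simp: power_int_mult_distrib prod.distrib intro!: exI[of _ "\<lambda>_. 1"]\<close>)

lemma evaluations_independent:
  fixes c :: "int ^ 'n \<Rightarrow> 'k alg_closure"
  assumes T: "finite T" "T \<subseteq> R"
    and zero: "\<And>x. x \<in> S \<Longrightarrow> (\<Sum>r\<in>T. c r * mpol_eval x (chi P \<alpha> r)) = 0"
    and "r \<in> T"
  shows "c r = 0"
proof (rule ccontr)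
  assume "c r \<noteq> 0"
  have TL: "T \<subseteq> lattice_points P" using T R_subset by blast
  define Z where "Z = {r \<in> T. c r \<noteq> 0}"
  have "\<forall>r\<in>T. \<exists>Q. Q face_of P \<and> rvec r \<in> face_interior Q"
    using lattice_point_in_face_interior TL by blast
  then obtain fc where fc: "\<And>r. r \<in> T \<Longrightarrow> fc r face_of P \<and> rvec r \<in> face_interior (fc r)"
    by metis
  have "finite (fc ` Z)" "fc ` Z \<noteq> {}" using T \<open>r \<in> T\<close> \<open>c r \<noteq> 0\<close> by (auto simp: Z_def)
  then obtain Q where "Q \<in> fc ` Z" and min: "\<And>Q'. Q' \<in> fc ` Z \<Longrightarrow> Q' \<subseteq> Q \<Longrightarrow> Q = Q'"
    using finite_has_minimal[of "fc ` Z"] by auto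
  then obtain r0 where r0: "r0 \<in> Z" "Q = fc r0" by blast
  have Q: "Q face_of P" "Q \<noteq> {}" using fc r0 by (auto simp: Z_def face_interior_def)
  \<comment> \<open>These exponents survive on the stratum of \<open>Q\<close>. The face of each one
    lies in \<open>Q\<close> and carries a nonzero coefficient, so minimality forces it to be
    \<open>Q\<close>.\<close>
  define T' where "T' = {r \<in> Z. rvec r \<in> Q}"
  have T': "T' \<subseteq> T" "finite T'" using T by (auto simp: T'_def Z_def)
  have interior: "rvec r \<in> face_interior Q" if "r \<in> T'" for r
  proof -
    have "r \<in> Z" "rvec r \<in> Q" using that by (auto simp: T'_def)
    hence "fc r face_of P" "rvec r \<in> face_interior (fc r)" using fc by (auto simp: Z_def)
    with \<open>rvec r \<in> Q\<close> have "fc r \<subseteq> Q"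
      using face_interior_subset polytope_imp_convex[OF polytope] Q by blast
    hence "Q = fc r" using min \<open>r \<in> Z\<close> by blast
    thus ?thesis using \<open>rvec r \<in> face_interior (fc r)\<close> by simp
  qed
  have "c r0 = 0"
  proof (rule reduced_characters_independent[OF T'(2) _ Q(1) interior])
    show "T' \<subseteq> R" using T T' by blast
    show "r0 \<in> T'" using r0 fc by (auto simp: T'_def Z_def face_interior_def)
    fix s :: "'n \<Rightarrow> 'k" assume s: "\<And>j. s j \<noteq> 0"
    from evaluation_point_on_face[where s = s, OF s Q] obtain x C where x: "x \<in> S" "C \<noteq> 0"
      "\<forall>m\<in>lattice_points P. mpol_eval x (chi P \<alpha> m) =
        (if rvec m \<in> Q then C * (\<Prod>j\<in>UNIV. to_ac (s j) powi (m $ j)) else 0)"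
      by blast
    have val: "mpol_eval x (chi P \<alpha> m) =
        (if rvec m \<in> Q then C * (\<Prod>j\<in>UNIV. to_ac (s j) powi (m $ j)) else 0)"
      if "m \<in> T" for m using that TL x(3) by blast
    have "0 = (\<Sum>r\<in>T. c r * mpol_eval x (chi P \<alpha> r))" using zero x(1) by simp
    \<comment> \<open>An exponent outside \<open>T'\<close> has coefficient 0 or lies off
      \<open>Q\<close>, where its monomial vanishes at \<open>x\<close>.\<close>
    also have "\<dots> = (\<Sum>r\<in>T'. c r * mpol_eval x (chi P \<alpha> r))"
      using T(1) T'(1) by (intro sum.mono_neutral_right) (auto simp: T'_def Z_def val split: if_splits)
    also have "\<dots> = (\<Sum>r\<in>T'. C * (c r * (\<Prod>j\<in>UNIV. to_ac (s j) powi (r $ j))))"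
      by (intro sum.cong) (auto simp: T'_def Z_def val)
    finally show "(\<Sum>r\<in>T'. c r * (\<Prod>j\<in>UNIV. to_ac (s j) powi (r $ j))) = 0"
      using x(2) by (simp flip: sum_distrib_left)
  qed
  thus False using r0 by (simp add: Z_def)
qed

section \<open>Linearity of the evaluation map\<close>

lemma chi_in_L_space: "m \<in> lattice_points P \<Longrightarrow> chi P \<alpha> m \<in> L_space P \<alpha>"
  by (simp add: L_space_def mpol.span_base)

lemma L_space_closed:
  assumes "f \<in> L_space P \<alpha>" "g \<in> L_space P \<alpha>"
  shows "mpol_scale c f + g \<in> L_space P \<alpha>"
  using assms by (auto simp: L_space_def intro: mpol.span_add mpol.span_scale)

lemma zero_in_L_space: "0 \<in> L_space P \<alpha>"
  by (simp add: L_space_def mpol.span_zero)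

lemma ev_zero: "ev S 0 = 0"
  by (simp add: ev_def mpol_eval_0 fun_eq_iff)

lemma to_ac_ev:
  assumes "x \<in> S" "f \<in> L_space P \<alpha>"
  shows "to_ac (ev S f x) = mpol_eval x f"
  using mpol_eval_in_range[OF lattice offsets reps assms] assms by (simp add: ev_def to_ac_of_ac)

text \<open>Values are compared after \<open>to_ac\<close>, since \<open>of_ac\<close> is controlled
  only on values from the base field; hence both polynomials lie in \<open>L_space\<close>. The form
  \<open>c f + g\<close> matches the step of \<open>span_induct_alt\<close>.\<close>

lemma ev_add_scale:
  assumes "f \<in> L_space P \<alpha>" "g \<in> L_space P \<alpha>"
  shows "ev S (mpol_scale c f + g) = word_scale c (ev S f) + ev S g"
proof
  fix x
  show "ev S (mpol_scale c f + g) x = (word_scale c (ev S f) + ev S g) x"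
  proof (cases "x \<in> S")
    case True
    have "to_ac (ev S (mpol_scale c f + g) x) = to_ac ((word_scale c (ev S f) + ev S g) x)"
      by (simp add: to_ac_ev True assms L_space_closed mpol_eval_add mpol_eval_scale word_scale_def)
    thus ?thesis using inj_to_ac by (metis injD)
  qed (simp add: ev_def word_scale_def)
qed

lemma ev_chi_reduce:
  assumes "m \<in> lattice_points P"
  shows "ev S (chi P \<alpha> (reduce CARD('k) P R m)) = ev S (chi P \<alpha> m)"
proof
  fix x
  show "ev S (chi P \<alpha> (reduce CARD('k) P R m)) x = ev S (chi P \<alpha> m) x"
  proof (cases "x \<in> S")
    case True
    then obtain Y where "Y \<in> rational_points P" "x \<in> Y"
      using reps by (auto simp: normalized_rep_system_def normalized_rep_def)
    hence "mpol_eval x (chi P \<alpha> (reduce CARD('k) P R m)) = mpol_eval x (chi P \<alpha> m)"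
      using reduce_properties[OF assms] R_subset assms by (intro proj_equiv_mpol_eval) auto
    thus ?thesis by (simp add: ev_def)
  qed (simp add: ev_def)
qed

section \<open>Basis and dimension of the code\<close>

lemma inj_on_ev_chi: "inj_on (\<lambda>r. ev S (chi P \<alpha> r)) R"
proof (rule inj_onI, rule ccontr)
  fix r r' assume r: "r \<in> R" "r' \<in> R" "ev S (chi P \<alpha> r) = ev S (chi P \<alpha> r')" "r \<noteq> r'"
  \<comment> \<open>Equal words would give a relation with coefficients 1 and -1 on two distinct
    exponents.\<close>
  define c :: "int ^ 'n \<Rightarrow> 'k alg_closure" where "c a = (if a = r then 1 else - 1)" for a
  have "c r = 0"
  proof (rule evaluations_independent[of "{r, r'}"])
    fix x assume x: "x \<in> S"
    have "mpol_eval x (chi P \<alpha> r) = mpol_eval x (chi P \<alpha> r')"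
      using r R_subset to_ac_ev[OF x] chi_in_L_space by (metis subsetD)
    thus "(\<Sum>a\<in>{r, r'}. c a * mpol_eval x (chi P \<alpha> a)) = 0"
      using r(4) by (simp add: c_def)
  qed (use r in auto)
  thus False by (simp add: c_def)
qed

lemma evaluation_coeffs_zero:
  fixes c :: "int ^ 'n \<Rightarrow> 'k"
  assumes "finite T" "T \<subseteq> R"
    and "\<And>x. x \<in> S \<Longrightarrow> (\<Sum>r\<in>T. to_ac (c r) * mpol_eval x (chi P \<alpha> r)) = 0" and "r \<in> T"
  shows "c r = 0"
proof -
  have "to_ac (c r) = to_ac 0"
    using evaluations_independent[of T "\<lambda>r. to_ac (c r)"] assms by simp
  thus ?thesis using inj_to_ac by (metis injD)
qed

lemma independent_ev_chi: "word.independent (ev S ` chi P \<alpha> ` R)"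
  unfolding word.independent_explicit_module
proof (intro allI impI)
  fix t and u :: "(('n, 'k) coords \<Rightarrow> 'k) \<Rightarrow> 'k" and v
  let ?E = "\<lambda>r. ev S (chi P \<alpha> r)"
  assume t: "finite t" "t \<subseteq> ev S ` chi P \<alpha> ` R" "(\<Sum>v\<in>t. word_scale (u v) v) = 0" "v \<in> t"
  then obtain T where T: "T \<subseteq> R" "finite T" "t = ?E ` T"
    using finite_subset_image[of t ?E R] by (auto simp: image_image)
  obtain r where r: "r \<in> T" "v = ?E r" using T t by blast
  have "u (?E r) = 0"
  proof (rule evaluation_coeffs_zero[OF T(2,1) _ r(1), of "\<lambda>r. u (?E r)"])
    fix x assume x: "x \<in> S"
    \<comment> \<open>By injectivity no two exponents share a word, so a sum over words is a sum
      over exponents.\<close>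
    have "(\<Sum>r\<in>T. word_scale (u (?E r)) (?E r)) = 0"
      using t(3) inj_on_subset[OF inj_on_ev_chi T(1)] by (simp add: T(3) sum.reindex)
    hence "(\<Sum>r\<in>T. word_scale (u (?E r)) (?E r)) x = 0" by simp
    moreover have "(\<Sum>r\<in>A. g r) x = (\<Sum>r\<in>A. g r x)"
      for A and g :: "int ^ 'n \<Rightarrow> ('n, 'k) coords \<Rightarrow> 'k"
      by (induction A rule: infinite_finite_induct) auto
    ultimately have "to_ac (\<Sum>r\<in>T. u (?E r) * ?E r x) = 0" by (simp add: word_scale_def)
    hence "(\<Sum>r\<in>T. to_ac (u (?E r)) * to_ac (?E r x)) = 0" by (simp add: to_ac_sum)
    moreover have "to_ac (?E r x) = mpol_eval x (chi P \<alpha> r)" if "r \<in> T" for r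
      using that T R_subset chi_in_L_space by (intro to_ac_ev x) blast
    ultimately show "(\<Sum>r\<in>T. to_ac (u (?E r)) * mpol_eval x (chi P \<alpha> r)) = 0" by simp
  qed
  thus "u v = 0" using r by simp
qed

lemma span_ev_chi: "word.span (ev S ` chi P \<alpha> ` R) = toric_code P \<alpha> S"
proof (intro equalityI subsetI)
  fix w assume "w \<in> word.span (ev S ` chi P \<alpha> ` R)"
  thus "w \<in> toric_code P \<alpha> S"
  proof (induction rule: word.span_induct_alt)
    case base
    show ?case
      unfolding toric_code_def using ev_zero[symmetric] zero_in_L_space by (rule image_eqI)
  next
    case (step c w v)
    then obtain r g where "r \<in> R" "w = ev S (chi P \<alpha> r)" "g \<in> L_space P \<alpha>" "v = ev S g"
      by (auto simp: toric_code_def)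
    moreover from this have "r \<in> lattice_points P" using R_subset by blast
    ultimately have "word_scale c w + v = ev S (mpol_scale c (chi P \<alpha> r) + g)"
      "mpol_scale c (chi P \<alpha> r) + g \<in> L_space P \<alpha>"
      by (simp_all add: ev_add_scale L_space_closed chi_in_L_space)
    thus ?case unfolding toric_code_def by (rule image_eqI)
  qed
next
  fix w assume "w \<in> toric_code P \<alpha> S"
  then obtain f where f: "f \<in> L_space P \<alpha>" "w = ev S f" by (auto simp: toric_code_def)
  \<comment> \<open>Membership in \<open>L_space\<close> is carried through the induction because
    \<open>ev_add_scale\<close> demands it of both summands.\<close>
  have "f \<in> L_space P \<alpha> \<and> ev S f \<in> word.span (ev S ` chi P \<alpha> ` R)"
    using f(1)[unfolded L_space_def]
  proof (induction rule: mpol.span_induct_alt)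
    case base
    show ?case
      unfolding ev_zero by (intro conjI zero_in_L_space word.span_zero)
  next
    case (step c h g)
    then obtain m where m: "m \<in> lattice_points P" "h = chi P \<alpha> m" by auto
    have "ev S h \<in> ev S ` chi P \<alpha> ` R"
      using ev_chi_reduce[OF m(1)] reduce_properties(1)[OF m(1)] m(2) by (metis imageI)
    hence "word_scale c (ev S h) + ev S g \<in> word.span (ev S ` chi P \<alpha> ` R)"
      using step by (intro word.span_add[OF word.span_scale[OF word.span_base]]) auto
    moreover have "h \<in> L_space P \<alpha>" using m by (simp add: chi_in_L_space)
    ultimately show ?case using step by (simp only: ev_add_scale L_space_closed simp_thms)
  qed
  thus "w \<in> word.span (ev S ` chi P \<alpha> ` R)" using f by simp
qed

lemma dim_toric_code: "word.dim (toric_code P \<alpha> S) = card R"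
proof -
  have "word.dim (toric_code P \<alpha> S) = card (ev S ` chi P \<alpha> ` R)"
    using word.dim_span_eq_card_independent[OF independent_ev_chi] by (simp add: span_ev_chi)
  also have "\<dots> = card R"
    using card_image[OF inj_on_ev_chi] by (simp add: image_image)
  finally show ?thesis .
qed

section \<open>The kernel of the evaluation map\<close>

lemma ev_injective_on_reduced_span:
  assumes g: "g \<in> mpol.span (chi P \<alpha> ` R)" and zero: "ev S g = 0"
  shows "g = 0"
proof -
  obtain t u where t: "finite t" "t \<subseteq> chi P \<alpha> ` R" "g = (\<Sum>a\<in>t. mpol_scale (u a) a)"
    using g by (auto simp: mpol.span_explicit)
  then obtain T where T: "T \<subseteq> R" "finite T" "t = chi P \<alpha> ` T"
    using finite_subset_image[OF t(1,2)] by blast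
  \<comment> \<open>Equal monomials have equal words, so injectivity on words passes to the
    monomials.\<close>
  have "inj_on (chi P \<alpha> :: _ \<Rightarrow> (_, 'k) mpol) T"
    using inj_on_subset[OF inj_on_ev_chi T(1)] unfolding inj_on_def by metis
  hence g_sum: "g = (\<Sum>r\<in>T. mpol_scale (u (chi P \<alpha> r)) (chi P \<alpha> r))"
    by (simp add: t(3) T(3) sum.reindex)
  have "chi P \<alpha> ` R \<subseteq> chi P \<alpha> ` lattice_points P" using R_subset by blast
  hence gL: "g \<in> L_space P \<alpha>"
    using g mpol.span_mono unfolding L_space_def by blast
  have "u (chi P \<alpha> r) = 0" if "r \<in> T" for r
  proof (rule evaluation_coeffs_zero[OF T(2,1) _ that, of "\<lambda>r. u (chi P \<alpha> r)"])
    fix x assume x: "x \<in> S"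
    have "mpol_eval x (\<Sum>r\<in>A. f r) = (\<Sum>r\<in>A. mpol_eval x (f r))"
      for A and f :: "int ^ 'n \<Rightarrow> (_, 'k) mpol"
      by (induction A rule: infinite_finite_induct) (auto simp: mpol_eval_add mpol_eval_0)
    hence "(\<Sum>r\<in>T. to_ac (u (chi P \<alpha> r)) * mpol_eval x (chi P \<alpha> r)) = mpol_eval x g"
      by (simp add: g_sum mpol_eval_scale)
    thus "(\<Sum>r\<in>T. to_ac (u (chi P \<alpha> r)) * mpol_eval x (chi P \<alpha> r)) = 0"
      using to_ac_ev[OF x gL] zero by simp
  qed
  thus ?thesis by (simp add: g_sum)
qed

text \<open>Each \<open>f\<close> in \<open>L_space\<close> is a combination of the differences plus
  some \<open>g\<close> in the span of the reduced monomials. Evaluation kills the differences and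
  is injective on that span, so for \<open>f\<close> in the kernel \<open>g\<close> is 0.\<close>

lemma kernel_ev:
  "{f \<in> L_space P \<alpha>. ev S f = 0} =
     mpol.span {chi P \<alpha> m - chi P \<alpha> (reduce CARD('k) P R m) | m.
       m \<in> lattice_points P \<and> m \<noteq> reduce CARD('k) P R m}" (is "_ = mpol.span ?D")
proof -
  have diff_L: "d \<in> L_space P \<alpha> \<and> ev S d = 0" if d: "d \<in> ?D" for d
  proof -
    obtain m where m: "m \<in> lattice_points P" "d = chi P \<alpha> m - chi P \<alpha> (reduce CARD('k) P R m)"
      using d by blast
    have r: "reduce CARD('k) P R m \<in> lattice_points P"
      using reduce_properties(1)[OF m(1)] R_subset by blast
    have d_eq: "d = mpol_scale (- 1) (chi P \<alpha> (reduce CARD('k) P R m)) + chi P \<alpha> m"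
      by (simp add: m(2) mpol.scale_minus_left)
    have "d \<in> L_space P \<alpha>"
      unfolding d_eq using m(1) r by (intro L_space_closed chi_in_L_space)
    moreover have "ev S d = word_scale (- 1) (ev S (chi P \<alpha> m)) + ev S (chi P \<alpha> m)"
      unfolding d_eq using m(1) r by (simp only: ev_add_scale chi_in_L_space ev_chi_reduce)
    hence "ev S d = 0" by (simp add: word_scale_def fun_eq_iff)
    ultimately show ?thesis by blast
  qed
  have kernel_closed: "f \<in> L_space P \<alpha> \<and> ev S f = 0" if "f \<in> mpol.span ?D" for f
    using that
  proof (induction rule: mpol.span_induct_alt)
    case base
    show ?case using zero_in_L_space ev_zero by blast
  next
    case (step c d g)
    thus ?case using diff_L[OF step(1)] by (simp add: L_space_closed ev_add_scale)
  qed
  have decompose: "\<exists>g\<in>mpol.span (chi P \<alpha> ` R). f - g \<in> mpol.span ?D" if "f \<in> L_space P \<alpha>" for f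
    using that unfolding L_space_def
  proof (induction rule: mpol.span_induct_alt)
    case base
    show ?case using mpol.span_zero[of ?D] mpol.span_zero by (intro bexI[of _ 0]) auto
  next
    case (step c h f)
    then obtain m g where m: "m \<in> lattice_points P" "h = chi P \<alpha> m"
      and g: "g \<in> mpol.span (chi P \<alpha> ` R)" "f - g \<in> mpol.span ?D" by auto
    let ?h = "chi P \<alpha> (reduce CARD('k) P R m)"
    \<comment> \<open>The generators exclude \<open>m = reduce CARD('k) P R m\<close>, but the
      difference is then 0.\<close>
    have "h - ?h \<in> mpol.span ?D"
      using m mpol.span_zero[of ?D] by (cases "m = reduce CARD('k) P R m") (auto intro!: mpol.span_base)
    hence "mpol_scale c (h - ?h) + (f - g) \<in> mpol.span ?D"
      using g(2) by (intro mpol.span_add mpol.span_scale)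
    also have "mpol_scale c (h - ?h) + (f - g) = (mpol_scale c h + f) - (mpol_scale c ?h + g)"
      by (simp add: mpol.scale_right_diff_distrib)
    finally show ?case
    proof (rule bexI)
      show "mpol_scale c ?h + g \<in> mpol.span (chi P \<alpha> ` R)"
        using g(1) reduce_properties(1)[OF m(1)]
        by (intro mpol.span_add[OF mpol.span_scale[OF mpol.span_base]]) auto
    qed
  qed
  have "f \<in> mpol.span ?D" if f: "f \<in> L_space P \<alpha>" "ev S f = 0" for f
  proof -
    obtain g where g: "g \<in> mpol.span (chi P \<alpha> ` R)" "f - g \<in> mpol.span ?D"
      using decompose f(1) by blast
    have "g = mpol_scale (- 1) (f - g) + f" by (simp add: mpol.scale_minus_left)
    hence "ev S g = 0"
      using ev_add_scale[of "f - g" f "- 1"] kernel_closed[OF g(2)] f by simp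
    hence "g = 0" using ev_injective_on_reduced_span g(1) by blast
    thus ?thesis using g(2) by simp
  qed
  thus ?thesis using kernel_closed by blast
qed

end

theorem theorem3p5:
  fixes P :: "(real ^ 'n) set"
    and \<alpha> :: "(real ^ 'n) set \<Rightarrow> int"
    and S :: "('n, 'k::{field,finite}) coords set"
    and R :: "(int ^ 'n) set"
  assumes "lattice_polytope P"
    and "aff_dim P = int CARD('n)"
    and "simple_polytope P"
    and "vertex_dets_coprime CHAR('k) P"
    and "facet_offsets P \<alpha>"
    and "normalized_rep_system P S"
    and "projective_reduction CARD('k) P R"
  shows "{f \<in> L_space P \<alpha>. ev S f = 0} =
           mpol.span {chi P \<alpha> m - chi P \<alpha> (reduce CARD('k) P R m) | m.
             m \<in> lattice_points P \<and> m \<noteq> reduce CARD('k) P R m} \<and>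
         word.independent (ev S ` chi P \<alpha> ` R) \<and>
         word.span (ev S ` chi P \<alpha> ` R) = toric_code P \<alpha> S \<and>
         word.dim (toric_code P \<alpha> S) = card R"
proof -
  interpret projective_toric_code P \<alpha> S R
    using assms by unfold_locales
  show ?thesis
    using kernel_ev independent_ev_chi span_ev_chi dim_toric_code by blast
qed

end
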